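(* Let $\widehat E=E+\varepsilon E_0$ and $\widehat F=F+\varepsilon F_0$ be dual matrices in $\mathbb{D}^{m\times n}$ whose dual Moore-Penrose generalized inverses (DMPGIs) exist. Then $\widehat E\overset{{\rm D}\text{-}\ast}{\leq}\widehat F$ (D-star partial order) if and only if $\widehat E\overset{\rm D}{\leq}\widehat F$ (Dual-minus partial order) and $$EF^{T}=(EF^{T})^{T},\qquad F^{T}E=(F^{T}E)^{T},$$ $$EE^\dagger(F_0-E_0)=(E^{T})^\dagger E_0^{T}(E-F),\qquad (F_0-E_0)E^\dagger E=(E-F)E_0^{T}(E^{T})^\dagger.$$
   Context: $\varepsilon$ is the dual unit: $\varepsilon\neq 0$, $\varepsilon^2=0$, commuting with reals. $\mathbb{D}^{m\times n}$ is the set of $m\times n$ dual matrices $\widehat E=E+\varepsilon E_0$ with $E,E_0\in\mathbb{R}^{m\times n}$, with the obvious addition, multiplication and transpose $\widehat E^{T}=E^T+\varepsilon E_0^T$. The DMPGI of $\widehat E\in\mathbb{D}^{m\times n}$ is the unique $\widehat X\in\mathbb{D}^{n\times m}$, if it exists, with $\widehat E\widehat X\widehat E=\widehat E$, $\widehat X\widehat E\widehat X=\widehat X$, $(\widehat E\widehat X)^T=\widehat E\widehat X$, $(\widehat X\widehat E)^T=\widehat X\widehat E$. For a real matrix $E$, $E^\dagger$ is the usual Moore-Penrose inverse. Minus partial order on real matrices of the same size: $E\leq F$ means $\mathrm{rk}(F-E)=\mathrm{rk}(F)-\mathrm{rk}(E)$. For $\widehat E,\widehat F\in\mathbb{D}^{m\times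 n}$ whose DMPGIs exist: (i) Dual-minus partial order: $\widehat E\overset{\rm D}{\leq}\widehat F$ means that $E\leq F$ and the DMPGI of $\widehat F-\widehat E$ exists. (ii) D-star partial order: $\widehat E\overset{{\rm D}\text{-}\ast}{\leq}\widehat F$ means $\widehat E^{T}\widehat E=\widehat E^{T}\widehat F$ and $\widehat E\widehat E^{T}=\widehat F\widehat E^{T}$. *)

theory Defs
  imports "HOL-Analysis.Analysis"
begin

text \<open>
  Dual numbers: \<open>Dual a b\<close> stands for \<open>a + b\<epsilon>\<close> with \<open>\<epsilon> \<noteq> 0\<close> and \<open>\<epsilon>\<^sup>2 = 0\<close>
  (see \<open>deps_nonzero\<close>, \<open>deps_square\<close> and \<open>Dual_eq_std_plus_deps\<close>).
\<close>

datatype dual_number = Dual (std_part: real) (inf_part: real)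

lemma dual_eqI:
  "std_part x = std_part y \<Longrightarrow> inf_part x = inf_part y \<Longrightarrow> x = y"
  by (rule dual_number.expand) simp

instantiation dual_number :: comm_ring_1
begin

definition "0 = Dual 0 0"
definition "1 = Dual 1 0"
definition "x + y = Dual (std_part x + std_part y) (inf_part x + inf_part y)"
definition "x - y = Dual (std_part x - std_part y) (inf_part x - inf_part y)"
definition "- x = Dual (- std_part x) (- inf_part x)"
definition "x * y =
  Dual (std_part x * std_part y) (std_part x * inf_part y + inf_part x * std_part y)"

instance
  by standard
    (auto intro!: dual_eqI simp: zero_dual_number_def one_dual_number_def
      plus_dual_number_def minus_dual_number_def uminus_dual_number_def
      times_dual_number_def algebra_simps)

end

definition deps :: dual_number where
  "deps = Dual 0 1"

lemma deps_nonzero: "deps \<noteq> 0"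
  by (simp add: deps_def zero_dual_number_def)

lemma deps_square: "deps * deps = 0"
  by (simp add: deps_def zero_dual_number_def times_dual_number_def)

lemma Dual_eq_std_plus_deps: "Dual a b = Dual a 0 + deps * Dual b 0"
  by (simp add: deps_def plus_dual_number_def times_dual_number_def)

text \<open>
  A dual \<open>m \<times> n\<close> matrix is a matrix over the dual numbers, so that addition,
  multiplication and transposition are those of the library.
  \<open>dual_mat A B\<close> is \<open>A + \<epsilon>B\<close>.
\<close>

definition dual_mat :: "real^'n^'m \<Rightarrow> real^'n^'m \<Rightarrow> dual_number^'n^'m" where
  "dual_mat A B = (\<chi> i j. Dual (A $ i $ j) (B $ i $ j))"

definition std_mat :: "dual_number^'n^'m \<Rightarrow> real^'n^'m" where
  "std_mat A = (\<chi> i j. std_part (A $ i $ j))"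

lemma std_mat_dual_mat [simp]: "std_mat (dual_mat A B) = A"
  by (simp add: std_mat_def dual_mat_def vec_eq_iff)

lemma dual_mat_add: "dual_mat A B + dual_mat C D = dual_mat (A + C) (B + D)"
  by (simp add: dual_mat_def vec_eq_iff plus_dual_number_def)

lemma dual_mat_diff: "dual_mat A B - dual_mat C D = dual_mat (A - C) (B - D)"
  by (simp add: dual_mat_def vec_eq_iff minus_dual_number_def)

lemma transpose_dual_mat: "transpose (dual_mat A B) = dual_mat (transpose A) (transpose B)"
  by (simp add: dual_mat_def transpose_def vec_eq_iff)

lemma sum_Dual: "(\<Sum>k\<in>K. Dual (f k) (g k)) = Dual (\<Sum>k\<in>K. f k) (\<Sum>k\<in>K. g k)"
  by (induction K rule: infinite_finite_induct)
    (simp_all add: zero_dual_number_def plus_dual_number_def)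

lemma dual_mat_mult:
  fixes A B :: "real^'n^'m" and C D :: "real^'p^'n"
  shows "dual_mat A B ** dual_mat C D = dual_mat (A ** C) (A ** D + B ** C)"
  by (simp add: dual_mat_def matrix_matrix_mult_def vec_eq_iff times_dual_number_def
      sum_Dual sum.distrib)

text \<open>
  The four Penrose equations over an arbitrary commutative ring; they are used both for
  real matrices (with value \<open>mp_inverse\<close>) and for dual matrices (where a solution need
  not exist). A solution is unique whenever it exists.
\<close>

definition is_mp_inverse :: "'a::comm_ring_1^'n^'m \<Rightarrow> 'a^'m^'n \<Rightarrow> bool" where
  "is_mp_inverse A X \<longleftrightarrow>
     A ** X ** A = A \<and> X ** A ** X = X \<and>
     transpose (A ** X) = A ** X \<and> transpose (X ** A) = X ** A"

lemma is_mp_inverse_unique: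
  assumes X: "is_mp_inverse A X" and Y: "is_mp_inverse A Y"
  shows "X = Y"
proof -
  have "A ** X = transpose (A ** Y ** A ** X)"
    using X Y by (simp add: is_mp_inverse_def)
  also have "\<dots> = transpose (A ** X) ** transpose (A ** Y)"
    by (simp add: matrix_transpose_mul matrix_mul_assoc)
  also have "\<dots> = A ** X ** A ** Y"
    using X Y by (simp add: is_mp_inverse_def matrix_mul_assoc)
  also have "\<dots> = A ** Y"
    using X by (simp add: is_mp_inverse_def)
  finally have AX: "A ** X = A ** Y" .
  have "X ** A = transpose (X ** (A ** Y ** A))"
    using X Y by (simp add: is_mp_inverse_def)
  also have "\<dots> = transpose (Y ** A) ** transpose (X ** A)"
    by (simp add: matrix_transpose_mul matrix_mul_assoc)
  also have "\<dots> = Y ** (A ** X ** A)"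
    using X Y by (simp add: is_mp_inverse_def matrix_mul_assoc [symmetric])
  also have "\<dots> = Y ** A"
    using X by (simp add: is_mp_inverse_def)
  finally have XA: "X ** A = Y ** A" .
  have "X = X ** A ** X"
    using X by (simp add: is_mp_inverse_def)
  also have "\<dots> = Y ** (A ** Y)"
    unfolding XA by (simp add: matrix_mul_assoc [symmetric] AX)
  also have "\<dots> = Y"
    using Y by (simp add: is_mp_inverse_def matrix_mul_assoc)
  finally show ?thesis .
qed

definition mp_inverse :: "real^'n^'m \<Rightarrow> real^'m^'n" where
  "mp_inverse A = (THE X. is_mp_inverse A X)"

definition has_dmpgi :: "dual_number^'n^'m \<Rightarrow> bool" where
  "has_dmpgi A \<longleftrightarrow> (\<exists>X. is_mp_inverse A X)"

text \<open>The ranks are taken as integers, so that the subtraction is not truncated.\<close>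

definition minus_le :: "real^'n^'m \<Rightarrow> real^'n^'m \<Rightarrow> bool" where
  "minus_le A B \<longleftrightarrow> int (rank (B - A)) = int (rank B) - int (rank A)"

text \<open>
  The next two relations are meant for dual matrices whose DMPGIs exist; this is
  not part of the definitions and has to be assumed separately.
\<close>

definition dual_minus_le :: "dual_number^'n^'m \<Rightarrow> dual_number^'n^'m \<Rightarrow> bool" where
  "dual_minus_le A B \<longleftrightarrow> minus_le (std_mat A) (std_mat B) \<and> has_dmpgi (B - A)"

definition dual_star_le :: "dual_number^'n^'m \<Rightarrow> dual_number^'n^'m \<Rightarrow> bool" where
  "dual_star_le A B \<longleftrightarrow>
     transpose A ** A = transpose A ** B \<and> A ** transpose A = B ** transpose A"

end

theory Submission
  imports Defs
begin

text \<open>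
  If \<open>A\<close> is below \<open>B\<close> in the star order over any commutative ring, then \<open>Y - X\<close> is the
  Moore-Penrose inverse of \<open>B - A\<close>, where \<open>X\<close> and \<open>Y\<close> are those of \<open>A\<close> and \<open>B\<close>; over the dual
  numbers this yields the DMPGI of the difference. Conversely, rank subtractivity makes the
  Moore-Penrose inverse of \<open>F\<close> an inner inverse of \<open>E\<close>, and the two symmetry conditions then turn
  the minus order into the star order of the standard parts. The two remaining conditions are the
  infinitesimal parts of the star equations, up to factors that can be cancelled because \<open>E + \<epsilon>E\<^sub>0\<close>
  has a DMPGI.
\<close>

section \<open>Matrix arithmetic and components of dual matrices\<close>

lemma matrix_add_rdistrib: "(A + B) ** C = A ** C + B ** C"
  by (vector matrix_matrix_mult_def sum.distrib[symmetric] field_simps)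

lemma matrix_diff_ldistrib: "(A :: 'a::ring_1^'n^'m) ** (B - C) = A ** B - A ** C"
  by (simp add: matrix_matrix_mult_def vec_eq_iff right_diff_distrib sum_subtractf)

lemma matrix_diff_rdistrib: "((A :: 'a::ring_1^'n^'m) - B) ** C = A ** C - B ** C"
  by (simp add: matrix_matrix_mult_def vec_eq_iff left_diff_distrib sum_subtractf)

lemma transpose_add: "transpose (A + B) = transpose A + transpose B"
  by (simp add: transpose_def vec_eq_iff)

lemma transpose_diff: "transpose (A - B) = transpose A - transpose B"
  by (simp add: transpose_def vec_eq_iff)

lemma matrix_mult_zero_right: "(A :: 'a::semiring_1^'n^'m) ** 0 = 0"
  by (simp add: matrix_matrix_mult_def vec_eq_iff)

lemma dual_mat_eq_iff: "dual_mat A B = dual_mat C D \<longleftrightarrow> A = C \<and> B = D"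
  by (auto simp: dual_mat_def vec_eq_iff)

lemma dual_mat_cases: obtains A B where "M = dual_mat A B"
proof
  show "M = dual_mat (std_mat M) (\<chi> i j. inf_part (M $ i $ j))"
    by (simp add: dual_mat_def std_mat_def vec_eq_iff)
qed

section \<open>Moore-Penrose inverses and the star order\<close>

lemma is_mp_inverseD:
  assumes "is_mp_inverse A X"
  shows "A ** X ** A = A" "X ** A ** X = X"
    "transpose X ** transpose A = A ** X" "transpose A ** transpose X = X ** A"
  using assms by (simp_all add: is_mp_inverse_def flip: matrix_transpose_mul)

lemma is_mp_inverse_transpose:
  assumes "is_mp_inverse A X"
  shows "is_mp_inverse (transpose A) (transpose X)"
proof -
  have "transpose (A ** X ** A) = transpose A" "transpose (X ** A ** X) = transpose X"
    "transpose (A ** X) = A ** X" "transpose (X ** A) = X ** A"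
    using assms by (simp_all add: is_mp_inverse_def)
  then show ?thesis
    unfolding is_mp_inverse_def by (simp add: matrix_transpose_mul matrix_mul_assoc)
qed

lemma mp_inverse_eqI: "is_mp_inverse A X \<Longrightarrow> mp_inverse A = X"
  unfolding mp_inverse_def by (blast intro: is_mp_inverse_unique)

text \<open>The equation for \<open>B\<close> is the infinitesimal part of the first Penrose
  equation. It amounts to \<open>(I - A X) B (I - X A) = 0\<close>, the form in which existence of a
  DMPGI enters the comparison of infinitesimal parts.\<close>

lemma has_dmpgi_dual_matE:
  assumes "has_dmpgi (dual_mat A B)"
  obtains X Y where "is_mp_inverse A X" "B = A ** X ** B + A ** Y ** A + B ** X ** A"
proof -
  obtain M where "is_mp_inverse (dual_mat A B) M"
    using assms by (auto simp: has_dmpgi_def)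
  moreover obtain X Y where "M = dual_mat X Y"
    by (rule dual_mat_cases)
  ultimately have "is_mp_inverse A X" "A ** X ** B + (A ** Y + B ** X) ** A = B"
    by (simp_all add: is_mp_inverse_def dual_mat_mult dual_mat_eq_iff transpose_dual_mat)
  then show thesis
    by (intro that [of X Y]) (simp_all add: matrix_add_rdistrib add.assoc)
qed

text \<open>\<open>X\<close> factors through \<open>transpose A\<close> on either side, so the star
  equations can be multiplied up to equations in \<open>X\<close>. The facts about \<open>Y\<close>
  follow because the symmetric idempotents of \<open>A\<close> are absorbed by those of
  \<open>B\<close>.\<close>

lemma mp_inverse_absorb_of_star_le:
  assumes X: "is_mp_inverse A X" and Y: "is_mp_inverse B Y"
    and left: "transpose A ** A = transpose A ** B"
    and right: "A ** transpose A = B ** transpose A"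
  shows "X ** B = X ** A" "B ** X = A ** X" "Y ** A = X ** A" "A ** Y = A ** X"
proof -
  have X1: "X = X ** transpose X ** transpose A" and X2: "X = transpose A ** transpose X ** X"
    using is_mp_inverseD [OF X] by (metis matrix_mul_assoc)+
  show XB: "X ** B = X ** A"
    using X1 left by (metis matrix_mul_assoc)
  show BX: "B ** X = A ** X"
    using X2 right by (metis matrix_mul_assoc)
  have A1: "A = A ** X ** B" and A2: "A = B ** X ** A"
    using X XB BX by (metis is_mp_inverseD matrix_mul_assoc)+
  have AYB: "A ** Y ** B = A"
    using A1 is_mp_inverseD(1) [OF Y] by (metis matrix_mul_assoc)
  have BYA: "B ** Y ** A = A"
    using A2 is_mp_inverseD(1) [OF Y] by (metis matrix_mul_assoc)
  \<comment> \<open>Transposition swaps the symmetric idempotents \<open>X ** A\<close> and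
    \<open>Y ** B\<close>; their product is \<open>X ** A\<close> in one order and
    \<open>Y ** A\<close> in the other.\<close>
  have "transpose (X ** A ** (Y ** B)) = Y ** B ** (X ** A)"
    by (simp add: matrix_transpose_mul is_mp_inverseD [OF X] is_mp_inverseD [OF Y])
  moreover have "X ** A ** (Y ** B) = X ** A"
    using AYB by (metis matrix_mul_assoc)
  moreover have "Y ** B ** (X ** A) = Y ** A"
    using A2 by (metis matrix_mul_assoc)
  ultimately show "Y ** A = X ** A"
    using X by (simp add: is_mp_inverse_def)
  have "transpose (B ** Y ** (A ** X)) = A ** X ** (B ** Y)"
    by (simp add: matrix_transpose_mul is_mp_inverseD [OF X] is_mp_inverseD [OF Y])
  moreover have "B ** Y ** (A ** X) = A ** X"
    using BYA by (metis matrix_mul_assoc)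
  moreover have "A ** X ** (B ** Y) = A ** Y"
    using A1 by (metis matrix_mul_assoc)
  ultimately show "A ** Y = A ** X"
    using X by (simp add: is_mp_inverse_def)
qed

lemma is_mp_inverse_diff_of_star_le:
  assumes X: "is_mp_inverse A X" and Y: "is_mp_inverse B Y"
    and left: "transpose A ** A = transpose A ** B"
    and right: "A ** transpose A = B ** transpose A"
  shows "is_mp_inverse (B - A) (Y - X)"
proof -
  note absorb = mp_inverse_absorb_of_star_le [OF assms]
  \<comment> \<open>By absorption all cross terms equal \<open>A ** X\<close> or
    \<open>X ** A\<close>, so both products are differences of nested symmetric idempotents.\<close>
  have l: "(B - A) ** (Y - X) = B ** Y - A ** X"
    and r: "(Y - X) ** (B - A) = Y ** B - X ** A"
    by (simp_all add: matrix_diff_ldistrib matrix_diff_rdistrib absorb)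
  have XY: "A ** X ** A = A" "X ** A ** X = X" "B ** Y ** B = B" "Y ** B ** Y = Y"
    using X Y by (simp_all add: is_mp_inverse_def)
  have mixed: "A ** X ** B = A" "B ** Y ** A = A" "Y ** A ** X = X" "X ** B ** Y = X"
    "X ** A ** Y = X" "Y ** B ** X = X"
    using XY absorb by (metis matrix_mul_assoc)+
  show ?thesis
    unfolding is_mp_inverse_def l r
    using X Y
    by (simp add: is_mp_inverse_def matrix_diff_ldistrib matrix_diff_rdistrib transpose_diff
        r matrix_mul_assoc mixed)
qed

section \<open>Rank subtractivity and its relation to the star order\<close>

lemma minus_le_transpose: "minus_le A B \<Longrightarrow> minus_le (transpose A) (transpose B)"
  by (simp add: minus_le_def rank_transpose flip: transpose_diff)

text \<open>The range of \<open>B\<close> lies in the sum of the ranges of \<open>A\<close> and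
  \<open>B - A\<close>, whose dimensions add up to that of the range of \<open>B\<close>. Hence the
  sum equals that range and is direct.\<close>

lemma minus_le_range:
  assumes "minus_le A B"
  shows "range ((*v) A) \<subseteq> range ((*v) B)" "range ((*v) A) \<inter> range ((*v) (B - A)) = {0}"
proof -
  let ?R = "\<lambda>M. range ((*v) M)"
  let ?S = "{x + y |x y. x \<in> ?R A \<and> y \<in> ?R (B - A)}"
  have sub: "subspace (?R M)" for M :: "real^'a^'b"
    by (simp add: linear_subspace_image)
  have le: "?R B \<subseteq> ?S"
  proof
    fix z assume "z \<in> ?R B"
    then obtain v where "z = A *v v + (B - A) *v v"
      by (auto simp: algebra_simps)
    then show "z \<in> ?S" by blast
  qed
  have dims: "dim ?S + dim (?R A \<inter> ?R (B - A)) = dim (?R B)"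
    using dim_sums_Int [OF sub sub, of A "B - A"] assms
    by (simp add: minus_le_def rank_dim_range)
  have "?R B = ?S"
    using dims le by (intro subspace_dim_equal sub subspace_sums) auto
  moreover have "?R A \<subseteq> ?S"
  proof
    fix z assume "z \<in> ?R A"
    moreover have "0 \<in> ?R (B - A)"
      using subspace_0 [OF sub] .
    ultimately show "z \<in> ?S"
      by (force intro: exI [of _ 0])
  qed
  ultimately show "?R A \<subseteq> ?R B" by simp
  have "dim (?R A \<inter> ?R (B - A)) = 0"
    using dims dim_subset [OF le] by linarith
  then show "?R A \<inter> ?R (B - A) = {0}"
    using subspace_0 [OF sub] by (auto simp: dim_eq_0)
qed

lemma minus_le_mp_inverse:
  assumes le: "minus_le A B" and Y: "is_mp_inverse B Y"
  shows "B ** Y ** A = A" "A ** Y ** B = A" "A ** Y ** A = A"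
proof -
  \<comment> \<open>\<open>D ** Z\<close> is the identity on the range of \<open>D\<close>. The
    dimensions are left free so that the fact also covers the transposes.\<close>
  have col: "D ** Z ** C = C" if CD: "minus_le C D" and inner: "D ** Z ** D = D"
    for C D :: "real^'p^'q" and Z
  proof (unfold matrix_eq, rule)
    fix v
    obtain w where "C *v v = D *v w"
      using minus_le_range(1) [OF CD] by blast
    then show "(D ** Z ** C) *v v = C *v v"
      using inner by (metis matrix_vector_mul_assoc)
  qed
  show BYA: "B ** Y ** A = A"
    using col [OF le] Y by (simp add: is_mp_inverse_def)
  have "transpose B ** transpose Y ** transpose A = transpose A"
    using col [OF minus_le_transpose [OF le]] is_mp_inverse_transpose [OF Y]
    by (simp add: is_mp_inverse_def)
  then show "A ** Y ** B = A"
    by (metis matrix_mul_assoc matrix_transpose_mul transpose_transpose)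
  show "A ** Y ** A = A"
  proof (unfold matrix_eq, rule)
    fix v
    \<comment> \<open>The columns of \<open>A - A ** Y ** A\<close> lie both in the range of
      \<open>B - A\<close> and in that of \<open>A\<close>, which meet only in zero.\<close>
    have "A *v v - (A ** Y ** A) *v v = (B - A) *v ((Y ** A) *v v)"
      using BYA by (simp add: matrix_vector_mul_assoc matrix_diff_rdistrib matrix_mul_assoc
          matrix_vector_mult_diff_rdistrib)
    moreover have "A *v v - (A ** Y ** A) *v v = A *v (v - (Y ** A) *v v)"
      by (simp add: matrix_vector_mult_diff_distrib matrix_vector_mul_assoc matrix_mul_assoc)
    ultimately show "(A ** Y ** A) *v v = A *v v"
      using minus_le_range(2) [OF le] by (metis (no_types, lifting) IntI eq_iff_diff_eq_0 rangeI singletonD)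
  qed
qed

text \<open>Here \<open>A ** Y\<close> is idempotent with the range of \<open>A\<close>; the symmetry of \<open>B\<^sup>T A\<close> makes it an
  orthogonal projector.\<close>

lemma star_left_of_minus_le:
  assumes le: "minus_le A B" and Y: "is_mp_inverse B Y"
    and sym: "transpose B ** A = transpose (transpose B ** A)"
  shows "transpose A ** A = transpose A ** B"
proof -
  note m = minus_le_mp_inverse [OF le Y]
  have sBA: "transpose B ** A = transpose A ** B"
    using sym by (simp add: matrix_transpose_mul)
  have proj: "transpose Y ** transpose B = B ** Y" "transpose B ** transpose Y = Y ** B"
    using is_mp_inverseD [OF Y] by simp_all
  have mt: "Y ** B ** transpose A = transpose A" "transpose A ** B ** Y = transpose A"
    using m proj by (metis matrix_mul_assoc matrix_transpose_mul)+
  have YB: "B ** Y ** transpose Y = transpose Y"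
    using is_mp_inverseD(2,3) [OF Y] by (metis matrix_mul_assoc matrix_transpose_mul)
  \<comment> \<open>The symmetric \<open>B ** Y\<close> is inserted before \<open>A\<close>,
    \<open>sBA\<close> exchanges the factors, and \<open>transpose A\<close> absorbs
    \<open>B ** Y\<close> again.\<close>
  have "A ** Y = transpose Y ** (transpose B ** A) ** Y"
    using m proj by (metis matrix_mul_assoc)
  also have "\<dots> = transpose Y ** transpose A"
    unfolding sBA using mt by (metis matrix_mul_assoc)
  finally have "A ** Y = transpose (A ** Y)"
    by (simp add: matrix_transpose_mul)
  then have "transpose A ** (A ** Y) = transpose A"
    using m(3) by (metis matrix_transpose_mul)
  then show ?thesis
    using m(2) by (metis matrix_mul_assoc)
qed

lemma star_of_minus_le:
  assumes le: "minus_le A B" and Y: "is_mp_inverse B Y"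
    and "A ** transpose B = transpose (A ** transpose B)"
    and "transpose B ** A = transpose (transpose B ** A)"
  shows "transpose A ** A = transpose A ** B" "A ** transpose A = B ** transpose A"
proof -
  show "transpose A ** A = transpose A ** B"
    using star_left_of_minus_le assms by blast
  \<comment> \<open>The second star equation is the first one for the transposes.\<close>
  have "transpose (transpose A) ** transpose A = transpose (transpose A) ** transpose B"
    using assms(3)
    by (intro star_left_of_minus_le [OF minus_le_transpose [OF le] is_mp_inverse_transpose [OF Y]])
      (simp add: matrix_transpose_mul)
  then show "A ** transpose A = B ** transpose A"
    by (metis matrix_transpose_mul transpose_transpose)
qed

text \<open>\<open>A ** X\<close> fixes the range of \<open>A\<close> and kills that of
  \<open>B - A\<close>, so these meet only in zero; together they span the range of
  \<open>B\<close>, and the ranks add.\<close>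

lemma minus_le_of_star:
  assumes X: "is_mp_inverse A X"
    and left: "transpose A ** A = transpose A ** B"
    and right: "A ** transpose A = B ** transpose A"
  shows "minus_le A B"
proof -
  let ?R = "\<lambda>M. range ((*v) M)"
  have sub: "subspace (?R M)" for M :: "real^'a^'b"
    by (simp add: linear_subspace_image)
  have BXA: "B ** X ** A = A"
    using right is_mp_inverseD(1,4) [OF X] by (metis matrix_mul_assoc)
  have AXB: "A ** X ** B = A"
    using left is_mp_inverseD(1,3) [OF X] by (metis matrix_mul_assoc)
  have "{x + y |x y. x \<in> ?R A \<and> y \<in> ?R (B - A)} = ?R B"
  proof (intro equalityI subsetI)
    fix z assume "z \<in> {x + y |x y. x \<in> ?R A \<and> y \<in> ?R (B - A)}"
    then obtain v w where "z = A *v v + (B - A) *v w" by blast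
    \<comment> \<open>\<open>B ** X ** A = A\<close> writes both \<open>A *v v\<close> and
      \<open>A *v w\<close> as images under \<open>B\<close>.\<close>
    also have "\<dots> = B *v ((X ** A) *v v + w - (X ** A) *v w)"
      using BXA by (simp add: algebra_simps matrix_vector_mul_assoc matrix_mul_assoc)
    finally show "z \<in> ?R B" by blast
  next
    fix z assume "z \<in> ?R B"
    then obtain v where "z = A *v v + (B - A) *v v"
      by (auto simp: algebra_simps)
    then show "z \<in> {x + y |x y. x \<in> ?R A \<and> y \<in> ?R (B - A)}" by blast
  qed
  moreover have "?R A \<inter> ?R (B - A) = {0}"
  proof -
    have "z = 0" if z: "z \<in> ?R A" "z \<in> ?R (B - A)" for z
    proof -
      obtain v w where v: "z = A *v v" and w: "z = (B - A) *v w"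
        using z by blast
      have "z = (A ** X) *v z"
        using v X by (simp add: is_mp_inverse_def matrix_vector_mul_assoc)
      also have "\<dots> = (A ** X ** B - A ** X ** A) *v w"
        by (simp add: w matrix_vector_mul_assoc matrix_diff_ldistrib)
      also have "\<dots> = 0"
        using AXB X by (simp add: is_mp_inverse_def)
      finally show ?thesis .
    qed
    then show ?thesis
      using subspace_0 [OF sub, of A] subspace_0 [OF sub, of "B - A"] by blast
  qed
  ultimately show ?thesis
    using dim_sums_Int [OF sub sub, of A "B - A"]
    by (simp add: minus_le_def rank_dim_range)
qed

section \<open>Infinitesimal parts of the star equations and the equivalence\<close>

text \<open>Multiplication by \<open>A\<^sup>T\<close> from the left undoes multiplication by \<open>X\<^sup>T\<close> since
  \<open>(I - X A) B\<^sup>T (I - A X) = 0\<close>, a consequence of the assumption on \<open>B\<close>, and \<open>A X G = 0\<close>.\<close>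

lemma dual_part_star_left_iff:
  fixes A B D G :: "real^'n^'m"
  assumes X: "is_mp_inverse A X"
    and B: "B = A ** X ** B + A ** Y ** A + B ** X ** A"
    and G: "transpose A ** G = 0"
  shows "transpose A ** D = transpose B ** G \<longleftrightarrow> A ** X ** D = transpose X ** transpose B ** G"
proof -
  have AX: "transpose X ** transpose A = A ** X" and XA: "transpose A ** transpose X = X ** A"
    using is_mp_inverseD [OF X] by simp_all
  show ?thesis
  proof
    assume "transpose A ** D = transpose B ** G"
    then show "A ** X ** D = transpose X ** transpose B ** G"
      using AX by (metis matrix_mul_assoc)
  next
    assume *: "A ** X ** D = transpose X ** transpose B ** G"
    have AXG: "A ** X ** G = 0"
      using G AX by (metis matrix_mul_assoc matrix_mult_zero_right)
    have "transpose (A ** X ** B) = transpose B ** (A ** X)"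
      by (simp add: matrix_transpose_mul AX)
    moreover have "transpose (A ** Y ** A) = transpose A ** transpose Y ** transpose A"
      "transpose (B ** X ** A) = X ** A ** transpose B"
      by (simp_all add: matrix_transpose_mul matrix_mul_assoc XA)
    ultimately have "transpose B = transpose B ** (A ** X) + transpose A ** transpose Y ** transpose A
        + X ** A ** transpose B"
      using B by (metis transpose_add)
    then have "transpose B ** G = (transpose B ** (A ** X)
        + transpose A ** transpose Y ** transpose A + X ** A ** transpose B) ** G"
      by simp
    also have "\<dots> = transpose B ** (A ** X ** G) + transpose A ** transpose Y ** (transpose A ** G)
        + X ** A ** transpose B ** G"
      by (simp add: matrix_add_rdistrib matrix_mul_assoc)
    finally have "transpose B ** G = X ** A ** transpose B ** G"
      by (simp add: AXG G matrix_mult_zero_right)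
    also have "\<dots> = transpose A ** (A ** X ** D)"
      by (simp add: * matrix_mul_assoc XA)
    also have "\<dots> = transpose A ** D"
      using is_mp_inverseD(1) [OF is_mp_inverse_transpose [OF X]] AX by (metis matrix_mul_assoc)
    finally show "transpose A ** D = transpose B ** G" by simp
  qed
qed

text \<open>Transposition reduces this to the left version for \<open>transpose A\<close>, whose
  Moore-Penrose inverse is \<open>transpose X\<close>.\<close>

lemma dual_part_star_right_iff:
  fixes A B D G :: "real^'n^'m"
  assumes X: "is_mp_inverse A X"
    and B: "B = A ** X ** B + A ** Y ** A + B ** X ** A"
    and G: "G ** transpose A = 0"
  shows "D ** transpose A = G ** transpose B \<longleftrightarrow> D ** X ** A = G ** transpose B ** transpose X"
proof -
  have "A ** transpose G = 0"
    using G by (metis matrix_transpose_mul transpose_transpose matrix_mult_zero_right)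
  moreover have "transpose B = transpose A ** transpose X ** transpose B
      + transpose A ** transpose Y ** transpose A + transpose B ** transpose X ** transpose A"
    by (subst B) (simp add: transpose_add matrix_transpose_mul matrix_mul_assoc add_ac)
  ultimately have "A ** transpose D = B ** transpose G \<longleftrightarrow>
      transpose A ** transpose X ** transpose D = X ** B ** transpose G"
    using dual_part_star_left_iff [OF is_mp_inverse_transpose [OF X],
        of "transpose B" "transpose Y" "transpose G" "transpose D"] by simp
  moreover have "A ** transpose D = B ** transpose G \<longleftrightarrow> D ** transpose A = G ** transpose B"
    by (metis matrix_transpose_mul transpose_transpose)
  moreover have "transpose (D ** X ** A) = transpose A ** transpose X ** transpose D"
    "transpose (G ** transpose B ** transpose X) = X ** B ** transpose G"
    by (simp_all add: matrix_transpose_mul matrix_mul_assoc)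
  ultimately show ?thesis by (metis transpose_iff)
qed

text \<open>The infinitesimal parts are grouped so that \<open>A - C\<close> appears, which
  \<open>transpose A\<close> annihilates from both sides by the first two equations.\<close>

lemma dual_star_le_dual_mat_iff:
  "dual_star_le (dual_mat A B) (dual_mat C D) \<longleftrightarrow>
    transpose A ** A = transpose A ** C \<and> A ** transpose A = C ** transpose A \<and>
    transpose A ** (D - B) = transpose B ** (A - C) \<and>
    (D - B) ** transpose A = (A - C) ** transpose B"
  by (auto simp: dual_star_le_def transpose_dual_mat dual_mat_mult dual_mat_eq_iff
      matrix_diff_ldistrib matrix_diff_rdistrib algebra_simps)

theorem theorem3p6:
  fixes E E0 F F0 :: "real^'n^'m"
  assumes "has_dmpgi (dual_mat E E0)" and "has_dmpgi (dual_mat F F0)"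
  shows "dual_star_le (dual_mat E E0) (dual_mat F F0) \<longleftrightarrow>
    dual_minus_le (dual_mat E E0) (dual_mat F F0) \<and>
    E ** transpose F = transpose (E ** transpose F) \<and>
    transpose F ** E = transpose (transpose F ** E) \<and>
    E ** mp_inverse E ** (F0 - E0) =
      mp_inverse (transpose E) ** transpose E0 ** (E - F) \<and>
    (F0 - E0) ** mp_inverse E ** E =
      (E - F) ** transpose E0 ** mp_inverse (transpose E)"
    (is "?star \<longleftrightarrow> ?minus \<and> ?sym1 \<and> ?sym2 \<and> ?dual1 \<and> ?dual2")
proof -
  obtain X X0 where X: "is_mp_inverse E X"
    and E0: "E0 = E ** X ** E0 + E ** X0 ** E + E0 ** X ** E"
    using has_dmpgi_dual_matE [OF assms(1)] .
  obtain Y where Y: "is_mp_inverse F Y"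
    using has_dmpgi_dual_matE [OF assms(2)] by blast
  note mp = mp_inverse_eqI [OF X] mp_inverse_eqI [OF is_mp_inverse_transpose [OF X]]
  let ?left = "transpose E ** E = transpose E ** F"
  let ?right = "E ** transpose E = F ** transpose E"
  \<comment> \<open>Each direction below first establishes the star equations of the standard parts,
    which make \<open>transpose E\<close> annihilate \<open>E - F\<close>.\<close>
  have dual: "?dual1 \<longleftrightarrow> transpose E ** (F0 - E0) = transpose E0 ** (E - F)"
      "?dual2 \<longleftrightarrow> (F0 - E0) ** transpose E = (E - F) ** transpose E0" if ?left ?right
  proof -
    have "transpose E ** (E - F) = 0" "(E - F) ** transpose E = 0"
      using that by (simp_all add: matrix_diff_ldistrib matrix_diff_rdistrib)
    then show "?dual1 \<longleftrightarrow> transpose E ** (F0 - E0) = transpose E0 ** (E - F)"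
      "?dual2 \<longleftrightarrow> (F0 - E0) ** transpose E = (E - F) ** transpose E0"
      unfolding mp
      using dual_part_star_left_iff [OF X E0] dual_part_star_right_iff [OF X E0] by simp_all
  qed
  show ?thesis
  proof
    assume star: ?star
    then have lr: ?left ?right
      by (simp_all add: dual_star_le_dual_mat_iff)
    \<comment> \<open>The lemma on differences is used over the dual numbers themselves, without
      splitting into parts.\<close>
    have "has_dmpgi (dual_mat F F0 - dual_mat E E0)"
      using assms star is_mp_inverse_diff_of_star_le
      unfolding has_dmpgi_def dual_star_le_def by blast
    then have ?minus
      using minus_le_of_star [OF X lr] by (simp add: dual_minus_le_def)
    moreover have ?sym1 ?sym2
      using lr by (metis matrix_transpose_mul transpose_transpose)+
    ultimately show "?minus \<and> ?sym1 \<and> ?sym2 \<and> ?dual1 \<and> ?dual2"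
      using dual [OF lr] star by (simp add: dual_star_le_dual_mat_iff)
  next
    assume *: "?minus \<and> ?sym1 \<and> ?sym2 \<and> ?dual1 \<and> ?dual2"
    then have "minus_le E F"
      by (simp add: dual_minus_le_def)
    then have lr: ?left ?right
      using star_of_minus_le Y * by blast+
    then show ?star
      using dual [OF lr] * by (simp add: dual_star_le_dual_mat_iff)
  qed
qed

end
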